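(* Let $\mathcal T$ be an effect-tribe with the Riesz Decomposition Property (RDP) of functions on a set $X\neq\emptyset$ such that every $f\in\mathcal T$ is $\mathcal B_0(\mathcal T)$-measurable, and let $s$ be a $\sigma$-additive state on $\mathcal T$. Then there is a unique probability measure $\mu$ on the $\sigma$-algebra $\mathcal B_0(\mathcal T)$ such that $$s(f)=\int_X f\,d\mu,\qquad f\in\mathcal T.$$ Moreover, $\mu=\mu_s$, where $\mu_s(A):=s(\chi_A)$ for $A\in\mathcal B_0(\mathcal T)$.
   Context: An effect algebra is a partial algebra $(E;+,0,1)$ with a partially defined binary operation $+$ and constants $0,1$ such that for all $a,b,c\in E$: (i) $a+b$ is defined iff $b+a$ is, and then $a+b=b+a$; (ii) $a+b$ and $(a+b)+c$ are defined iff $b+c$ and $a+(b+c)$ are, and then $(a+b)+c=a+(b+c)$; (iii) for each $a$ there is a unique $a'$ with $a+a'=1$; (iv) if $a+1$ is defined then $a=0$. The partial order is $a\le b$ iff $a+c=b$ for some $c\in E$. $E$ satisfies (RDP) if $x_1+x_2=y_1+y_2$ implies there are $c_{11},c_{12},c_{21},c_{22}\in E$ with $x_1=c_{11}+c_{12}$, $x_2=c_{21}+c_{22}$, $y_1=c_{11}+c_{21}$, $y_2=c_{12}+c_{22}$. An effect-tribe on a set $X\ne\emptyset$ is a system $\mathcal T\subseteq[0,1]^X$ such that (i) $1\in\mathcal T$; (ii) $f\in\mathcal T$ implies $1-f\in\mathcal T$; (iii) $f,g\in\mathcal T$ and $f\le 1-g$ pointwise imply $f+g\in\mathcal T$; (iv)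 if $f_n\in\mathcal T$ and $f_n\nearrow f$ pointwise, then $f\in\mathcal T$. It is an effect algebra under pointwise $+$ (defined when $f\le 1-g$), with the pointwise order. An element $e$ of an effect algebra $E$ is central if there is an isomorphism $f_e:E\to[0,e]\times[0,e']$ (where $[0,e]=\{x\in E:x\le e\}$ is the effect algebra with $+$ restricted and unit $e$, and similarly for $[0,e']$) such that $f_e(e)=(e,0)$ and, whenever $f_e(x)=(x_1,x_2)$, $x=x_1+x_2$. $B(E)$ is the set of central elements. $\mathcal B_0(\mathcal T):=\{A\subseteq X:\chi_A\in B(\mathcal T)\}$; when $\mathcal T$ is an effect-tribe this is a $\sigma$-algebra of subsets of $X$. A state on $E$ is a map $s:E\to[0,1]$ with $s(1)=1$ and $s(a+b)=s(a)+s(b)$ whenever $a+b$ is defined. It is $\sigma$-additive if $a_n\le a_{n+1}$ for all $n$ and $a=\bigvee_n a_n\in E$ imply $s(a)=\lim_n s(a_n)$. *)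

theory Defs
  imports "HOL-Probability.Probability"
begin

text \<open>Partial algebras \<open>(E; +, 0, 1)\<close> with an explicit carrier. The partial operation returns
  \<open>None\<close> where it is undefined; its values off the carrier are irrelevant.\<close>

record 'a partial_algebra =
  ea_carrier :: "'a set"
  ea_add :: "'a \<Rightarrow> 'a \<Rightarrow> 'a option"
  ea_zero :: 'a
  ea_one :: 'a

text \<open>Both sides of \<open>comm\<close> and of \<open>assoc\<close> are options, so each equation states that one side is
  defined iff the other is, and that the values then agree.\<close>

locale effect_algebra =
  fixes E :: "'a partial_algebra"
  assumes zero_closed: "ea_zero E \<in> ea_carrier E"
    and one_closed: "ea_one E \<in> ea_carrier E"
    and add_closed: "\<lbrakk>a \<in> ea_carrier E; b \<in> ea_carrier E; ea_add E a b = Some c\<rbrakk>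
          \<Longrightarrow> c \<in> ea_carrier E"
    and comm: "\<lbrakk>a \<in> ea_carrier E; b \<in> ea_carrier E\<rbrakk> \<Longrightarrow> ea_add E a b = ea_add E b a"
    and assoc: "\<lbrakk>a \<in> ea_carrier E; b \<in> ea_carrier E; c \<in> ea_carrier E\<rbrakk>
          \<Longrightarrow> Option.bind (ea_add E a b) (\<lambda>d. ea_add E d c) =
              Option.bind (ea_add E b c) (\<lambda>d. ea_add E a d)"
    and compl: "a \<in> ea_carrier E \<Longrightarrow> \<exists>!a'. a' \<in> ea_carrier E \<and> ea_add E a a' = Some (ea_one E)"
    and zero_one: "\<lbrakk>a \<in> ea_carrier E; ea_add E a (ea_one E) \<noteq> None\<rbrakk> \<Longrightarrow> a = ea_zero E"

definition ea_le :: "'a partial_algebra \<Rightarrow> 'a \<Rightarrow> 'a \<Rightarrow> bool" where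
  "ea_le E a b \<longleftrightarrow> (\<exists>c\<in>ea_carrier E. ea_add E a c = Some b)"

definition ea_compl :: "'a partial_algebra \<Rightarrow> 'a \<Rightarrow> 'a" where
  "ea_compl E a = (THE a'. a' \<in> ea_carrier E \<and> ea_add E a a' = Some (ea_one E))"

definition ea_RDP :: "'a partial_algebra \<Rightarrow> bool" where
  "ea_RDP E \<longleftrightarrow>
    (\<forall>x1\<in>ea_carrier E. \<forall>x2\<in>ea_carrier E. \<forall>y1\<in>ea_carrier E. \<forall>y2\<in>ea_carrier E.
      ea_add E x1 x2 \<noteq> None \<and> ea_add E x1 x2 = ea_add E y1 y2 \<longrightarrow>
      (\<exists>c11\<in>ea_carrier E. \<exists>c12\<in>ea_carrier E. \<exists>c21\<in>ea_carrier E. \<exists>c22\<in>ea_carrier E.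
        ea_add E c11 c12 = Some x1 \<and> ea_add E c21 c22 = Some x2 \<and>
        ea_add E c11 c21 = Some y1 \<and> ea_add E c12 c22 = Some y2))"

definition ea_interval :: "'a partial_algebra \<Rightarrow> 'a \<Rightarrow> 'a partial_algebra" where
  "ea_interval E e = \<lparr>
    ea_carrier = {x \<in> ea_carrier E. ea_le E x e},
    ea_add = (\<lambda>a b. case ea_add E a b of
                None \<Rightarrow> None
              | Some c \<Rightarrow> if ea_le E c e then Some c else None),
    ea_zero = ea_zero E,
    ea_one = e\<rparr>"

definition ea_prod :: "'a partial_algebra \<Rightarrow> 'b partial_algebra \<Rightarrow> ('a \<times> 'b) partial_algebra" where
  "ea_prod E F = \<lparr>
    ea_carrier = ea_carrier E \<times> ea_carrier F,
    ea_add = (\<lambda>p q. case (ea_add E (fst p) (fst q), ea_add F (snd p) (snd q)) of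
                (Some c, Some d) \<Rightarrow> Some (c, d)
              | _ \<Rightarrow> None),
    ea_zero = (ea_zero E, ea_zero F),
    ea_one = (ea_one E, ea_one F)\<rparr>"

definition ea_hom :: "'a partial_algebra \<Rightarrow> 'b partial_algebra \<Rightarrow> ('a \<Rightarrow> 'b) \<Rightarrow> bool" where
  "ea_hom E F h \<longleftrightarrow>
    h \<in> ea_carrier E \<rightarrow> ea_carrier F \<and> h (ea_one E) = ea_one F \<and>
    (\<forall>a\<in>ea_carrier E. \<forall>b\<in>ea_carrier E. \<forall>c.
      ea_add E a b = Some c \<longrightarrow> ea_add F (h a) (h b) = Some (h c))"

definition ea_iso :: "'a partial_algebra \<Rightarrow> 'b partial_algebra \<Rightarrow> ('a \<Rightarrow> 'b) \<Rightarrow> bool" where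
  "ea_iso E F h \<longleftrightarrow>
    bij_betw h (ea_carrier E) (ea_carrier F) \<and> ea_hom E F h \<and>
    ea_hom F E (inv_into (ea_carrier E) h)"

definition ea_central :: "'a partial_algebra \<Rightarrow> 'a set" where
  "ea_central E = {e \<in> ea_carrier E.
    \<exists>h. ea_iso E (ea_prod (ea_interval E e) (ea_interval E (ea_compl E e))) h \<and>
        h e = (e, ea_zero E) \<and>
        (\<forall>x\<in>ea_carrier E. ea_add E (fst (h x)) (snd (h x)) = Some x)}"

definition ea_state :: "'a partial_algebra \<Rightarrow> ('a \<Rightarrow> real) \<Rightarrow> bool" where
  "ea_state E s \<longleftrightarrow>
    s \<in> ea_carrier E \<rightarrow> {0..1} \<and> s (ea_one E) = 1 \<and>
    (\<forall>a\<in>ea_carrier E. \<forall>b\<in>ea_carrier E. \<forall>c. ea_add E a b = Some c \<longrightarrow> s c = s a + s b)"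

definition ea_is_sup :: "'a partial_algebra \<Rightarrow> 'a set \<Rightarrow> 'a \<Rightarrow> bool" where
  "ea_is_sup E S a \<longleftrightarrow>
    a \<in> ea_carrier E \<and> (\<forall>b\<in>S. ea_le E b a) \<and>
    (\<forall>u\<in>ea_carrier E. (\<forall>b\<in>S. ea_le E b u) \<longrightarrow> ea_le E a u)"

definition ea_sigma_additive :: "'a partial_algebra \<Rightarrow> ('a \<Rightarrow> real) \<Rightarrow> bool" where
  "ea_sigma_additive E s \<longleftrightarrow>
    (\<forall>A a. range A \<subseteq> ea_carrier E \<and> (\<forall>n::nat. ea_le E (A n) (A (Suc n))) \<and>
           ea_is_sup E (range A) a \<longrightarrow> (\<lambda>n. s (A n)) \<longlonglongrightarrow> s a)"

text \<open>A function on the set \<open>X\<close> is a HOL function that is \<open>undefined\<close> outside \<open>X\<close>, so that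
  equality of functions is equality on \<open>X\<close>; hence the restrictions \<open>\<lambda>x\<in>X. _\<close> below.\<close>

definition effect_tribe :: "'a set \<Rightarrow> ('a \<Rightarrow> real) set \<Rightarrow> bool" where
  "effect_tribe X T \<longleftrightarrow>
    X \<noteq> {} \<and> T \<subseteq> (X \<rightarrow>\<^sub>E {0..1}) \<and>
    (\<lambda>x\<in>X. 1) \<in> T \<and>
    (\<forall>f\<in>T. (\<lambda>x\<in>X. 1 - f x) \<in> T) \<and>
    (\<forall>f\<in>T. \<forall>g\<in>T. (\<forall>x\<in>X. f x \<le> 1 - g x) \<longrightarrow> (\<lambda>x\<in>X. f x + g x) \<in> T) \<and>
    (\<forall>F f. range F \<subseteq> T \<and> (\<forall>n::nat. \<forall>x\<in>X. F n x \<le> F (Suc n) x) \<and>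
           f \<in> extensional X \<and> (\<forall>x\<in>X. (\<lambda>n. F n x) \<longlonglongrightarrow> f x) \<longrightarrow> f \<in> T)"

definition tribe_algebra :: "'a set \<Rightarrow> ('a \<Rightarrow> real) set \<Rightarrow> ('a \<Rightarrow> real) partial_algebra" where
  "tribe_algebra X T = \<lparr>
    ea_carrier = T,
    ea_add = (\<lambda>f g. if \<forall>x\<in>X. f x \<le> 1 - g x then Some (\<lambda>x\<in>X. f x + g x) else None),
    ea_zero = (\<lambda>x\<in>X. 0),
    ea_one = (\<lambda>x\<in>X. 1)\<rparr>"

lemma tribe_algebra_simps [simp]:
  "ea_carrier (tribe_algebra X T) = T"
  "ea_add (tribe_algebra X T) f g =
     (if \<forall>x\<in>X. f x \<le> 1 - g x then Some (\<lambda>x\<in>X. f x + g x) else None)"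
  "ea_zero (tribe_algebra X T) = (\<lambda>x\<in>X. 0)"
  "ea_one (tribe_algebra X T) = (\<lambda>x\<in>X. 1)"
  by (simp_all add: tribe_algebra_def)

lemma effect_algebra_tribe_algebra:
  assumes "effect_tribe X T"
  shows "effect_algebra (tribe_algebra X T)"
proof
  have sub: "T \<subseteq> X \<rightarrow>\<^sub>E {0..1}" and one: "(\<lambda>x\<in>X. 1) \<in> T"
    and minus: "\<And>f. f \<in> T \<Longrightarrow> (\<lambda>x\<in>X. 1 - f x) \<in> T"
    and plus: "\<And>f g. f \<in> T \<Longrightarrow> g \<in> T \<Longrightarrow> (\<forall>x\<in>X. f x \<le> 1 - g x) \<Longrightarrow> (\<lambda>x\<in>X. f x + g x) \<in> T"
    using assms unfolding effect_tribe_def by blast+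
  have bd: "0 \<le> f x \<and> f x \<le> 1" if "f \<in> T" "x \<in> X" for f x
    using sub that by (auto simp: PiE_def Pi_def)
  have ext: "f \<in> extensional X" if "f \<in> T" for f
    using sub that by (auto simp: PiE_def)
  let ?E = "tribe_algebra X T"
  show "ea_one ?E \<in> ea_carrier ?E"
    using one by simp
  have "(\<lambda>x\<in>X. 1 - (\<lambda>x\<in>X. 1 :: real) x) = (\<lambda>x\<in>X. 0)"
    by (rule restrict_ext) simp
  then show "ea_zero ?E \<in> ea_carrier ?E"
    using minus[OF one] by simp
  show "c \<in> ea_carrier ?E"
    if "a \<in> ea_carrier ?E" "b \<in> ea_carrier ?E" "ea_add ?E a b = Some c" for a b c
    using that plus by (auto split: if_splits)
  show "ea_add ?E a b = ea_add ?E b a" for a b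
    by (auto simp: fun_eq_iff restrict_def algebra_simps)
  show "Option.bind (ea_add ?E a b) (\<lambda>d. ea_add ?E d c) =
        Option.bind (ea_add ?E b c) (\<lambda>d. ea_add ?E a d)"
    if "a \<in> ea_carrier ?E" "b \<in> ea_carrier ?E" "c \<in> ea_carrier ?E" for a b c
  proof -
    have "(\<forall>x\<in>X. a x \<le> 1 - b x) \<and> (\<forall>x\<in>X. a x + b x \<le> 1 - c x) \<longleftrightarrow>
          (\<forall>x\<in>X. a x + b x \<le> 1 - c x)"
      using bd[of a] bd[of b] bd[of c] that by fastforce
    moreover have "(\<forall>x\<in>X. b x \<le> 1 - c x) \<and> (\<forall>x\<in>X. a x \<le> 1 - (b x + c x)) \<longleftrightarrow>
          (\<forall>x\<in>X. a x + b x \<le> 1 - c x)"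
      using bd[of a] bd[of b] bd[of c] that by fastforce
    ultimately show ?thesis
      by (auto simp: fun_eq_iff restrict_def algebra_simps)
  qed
  show "\<exists>!a'. a' \<in> ea_carrier ?E \<and> ea_add ?E a a' = Some (ea_one ?E)"
    if "a \<in> ea_carrier ?E" for a
  proof (rule ex1I[of _ "\<lambda>x\<in>X. 1 - a x"])
    show "(\<lambda>x\<in>X. 1 - a x) \<in> ea_carrier ?E \<and> ea_add ?E a (\<lambda>x\<in>X. 1 - a x) = Some (ea_one ?E)"
      using minus[of a] that by (auto simp: fun_eq_iff)
  next
    fix b assume b: "b \<in> ea_carrier ?E \<and> ea_add ?E a b = Some (ea_one ?E)"
    then have eq: "(\<lambda>x\<in>X. a x + b x) = (\<lambda>x\<in>X. 1)"
      by (simp split: if_splits)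
    show "b = (\<lambda>x\<in>X. 1 - a x)"
    proof
      fix x show "b x = (\<lambda>x\<in>X. 1 - a x) x"
        using fun_cong[OF eq, of x] ext[of b] b
        by (cases "x \<in> X") (auto simp: extensional_def)
    qed
  qed
  show "a = ea_zero ?E" if "a \<in> ea_carrier ?E" "ea_add ?E a (ea_one ?E) \<noteq> None" for a
  proof
    fix x show "a x = ea_zero ?E x"
      using that bd[of a x] ext[of a]
      by (cases "x \<in> X") (auto simp: extensional_def split: if_splits)
  qed
qed

definition chi :: "'a set \<Rightarrow> 'a set \<Rightarrow> 'a \<Rightarrow> real" where
  "chi X A = (\<lambda>x\<in>X. indicator A x)"

definition tribe_B0 :: "'a set \<Rightarrow> ('a \<Rightarrow> real) set \<Rightarrow> 'a set set" where
  "tribe_B0 X T = {A. A \<subseteq> X \<and> chi X A \<in> ea_central (tribe_algebra X T)}"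

definition prob_measure_on :: "'a set \<Rightarrow> 'a set set \<Rightarrow> 'a measure \<Rightarrow> bool" where
  "prob_measure_on X S M \<longleftrightarrow> prob_space M \<and> space M = X \<and> sets M = S"

definition tribe_mu :: "'a set \<Rightarrow> (('a \<Rightarrow> real) \<Rightarrow> real) \<Rightarrow> 'a set \<Rightarrow> real" where
  "tribe_mu X s A = s (chi X A)"

end

theory Submission
  imports Defs
begin

text \<open>A set \<open>A\<close> belongs to \<open>\<B>\<^sub>0(\<T>)\<close> iff multiplication by \<open>\<chi>\<^sub>A\<close> preserves \<open>\<T>\<close>, so \<open>\<B>\<^sub>0(\<T>)\<close> is a
  \<open>\<sigma>\<close>-algebra and \<open>\<mu>\<^sub>s\<close> is a probability measure on it. Since \<open>\<T>\<close> need not contain the multiples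
  \<open>c \<cdot> \<chi>\<^sub>A\<close>, integrals cannot be compared by approximation with simple functions. Instead, consider
  the defect \<open>d(f) = s(f) - \<integral>f d\<mu>\<^sub>s\<close>, which is additive, bounded by \<open>1\<close> and zero on every \<open>\<chi>\<^sub>A\<close>. The
  doubling map, \<open>2f\<close> where \<open>f < 1/2\<close> and \<open>2f - 1\<close> elsewhere, preserves \<open>\<T>\<close> and doubles \<open>d\<close>;
  iterating it forces \<open>d = 0\<close>.\<close>

section \<open>Closure properties and pointwise order of an effect-tribe\<close>

locale effect_tribe_loc =
  fixes X :: "'a set" and T :: "('a \<Rightarrow> real) set"
  assumes tribe: "effect_tribe X T"
begin

abbreviation E :: "('a \<Rightarrow> real) partial_algebra" where
  "E \<equiv> tribe_algebra X T"

abbreviation B0 :: "'a set set" where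
  "B0 \<equiv> tribe_B0 X T"

lemma tribe_range: "0 \<le> f x" "f x \<le> 1" if "f \<in> T" "x \<in> X"
  using tribe that unfolding effect_tribe_def by (auto simp: PiE_def Pi_def)

lemma tribe_extensional: "f \<in> extensional X" if "f \<in> T"
  using tribe that unfolding effect_tribe_def by (auto simp: PiE_def)

text \<open>Members of \<open>T\<close> are \<open>undefined\<close> off \<open>X\<close>, so
  agreement on \<open>X\<close> is already equality. This lets a nested term built by closure
  properties be replaced by a plain formula with the same values.\<close>

lemma tribe_restrict_cong: "(\<lambda>x\<in>X. g x) \<in> T" if "f \<in> T" "\<And>x. x \<in> X \<Longrightarrow> g x = f x"
proof -
  have "(\<lambda>x\<in>X. g x) = f"
    by (rule extensionalityI[of _ X]) (auto simp: that tribe_extensional)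
  then show ?thesis using that by simp
qed

lemma one_tribe: "(\<lambda>x\<in>X. 1) \<in> T"
  and compl_tribe: "f \<in> T \<Longrightarrow> (\<lambda>x\<in>X. 1 - f x) \<in> T"
  and add_tribe: "f \<in> T \<Longrightarrow> g \<in> T \<Longrightarrow> (\<And>x. x \<in> X \<Longrightarrow> f x + g x \<le> 1) \<Longrightarrow> (\<lambda>x\<in>X. f x + g x) \<in> T"
proof -
  show "(\<lambda>x\<in>X. 1) \<in> T" "f \<in> T \<Longrightarrow> (\<lambda>x\<in>X. 1 - f x) \<in> T"
    using tribe unfolding effect_tribe_def by blast+
  assume "f \<in> T" "g \<in> T" and le: "\<And>x. x \<in> X \<Longrightarrow> f x + g x \<le> 1"
  moreover have "\<forall>x\<in>X. f x \<le> 1 - g x" using le by (simp add: le_diff_eq)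
  ultimately show "(\<lambda>x\<in>X. f x + g x) \<in> T"
    using tribe unfolding effect_tribe_def by blast
qed

lemma lim_tribe:
  assumes "\<And>n::nat. F n \<in> T" "\<And>n x. x \<in> X \<Longrightarrow> F n x \<le> F (Suc n) x"
    and "\<And>x. x \<in> X \<Longrightarrow> (\<lambda>n. F n x) \<longlonglongrightarrow> f x"
  shows "(\<lambda>x\<in>X. f x) \<in> T"
proof -
  have "range F \<subseteq> T \<and> (\<forall>n. \<forall>x\<in>X. F n x \<le> F (Suc n) x) \<and> restrict f X \<in> extensional X
      \<and> (\<forall>x\<in>X. (\<lambda>n. F n x) \<longlonglongrightarrow> restrict f X x)"
    using assms by auto
  then show ?thesis
    using tribe unfolding effect_tribe_def by blast
qed

text \<open>Holds because g - f = 1 - (f + (1 - g)), where the inner sum stays below 1 exactly when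
  f \<le> g.\<close>

lemma diff_tribe:
  assumes "f \<in> T" "g \<in> T" "\<And>x. x \<in> X \<Longrightarrow> f x \<le> g x"
  shows "(\<lambda>x\<in>X. g x - f x) \<in> T"
proof (rule tribe_restrict_cong)
  show "(\<lambda>x\<in>X. 1 - (\<lambda>x\<in>X. f x + (\<lambda>x\<in>X. 1 - g x) x) x) \<in> T"
    using assms by (intro compl_tribe add_tribe) auto
qed simp

text \<open>The summand witnessing the algebraic order can only be g - f, which
  \<open>diff_tribe\<close> places in \<open>T\<close>; conversely, every summand is
  nonnegative.\<close>

lemma tribe_le_iff: "ea_le E f g \<longleftrightarrow> (\<forall>x\<in>X. f x \<le> g x)" if "f \<in> T" "g \<in> T"
proof
  assume "ea_le E f g"
  then obtain c where c: "c \<in> T" "(\<lambda>x\<in>X. f x + c x) = g"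
    unfolding ea_le_def by (auto split: if_splits)
  show "\<forall>x\<in>X. f x \<le> g x"
  proof
    fix x assume "x \<in> X"
    then show "f x \<le> g x" using fun_cong[OF c(2), of x] tribe_range(1)[OF c(1)] by force
  qed
next
  assume le: "\<forall>x\<in>X. f x \<le> g x"
  have "(\<lambda>x\<in>X. f x + (\<lambda>x\<in>X. g x - f x) x) = g"
    by (rule extensionalityI[of _ X]) (auto simp: that tribe_extensional)
  moreover have "\<forall>x\<in>X. f x \<le> 1 - (\<lambda>x\<in>X. g x - f x) x"
    using tribe_range that by simp
  ultimately show "ea_le E f g"
    unfolding ea_le_def using diff_tribe[OF that] le
    by (intro bexI[of _ "\<lambda>x\<in>X. g x - f x"]) (simp_all del: restrict_apply)
qed

lemma tribe_compl: "ea_compl E f = (\<lambda>x\<in>X. 1 - f x)" if "f \<in> T"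
  unfolding ea_compl_def
proof (rule the1_equality)
  show "\<exists>!a'. a' \<in> ea_carrier E \<and> ea_add E f a' = Some (ea_one E)"
    using effect_algebra.compl[OF effect_algebra_tribe_algebra[OF tribe]] that by simp
  show "(\<lambda>x\<in>X. 1 - f x) \<in> ea_carrier E \<and> ea_add E f (\<lambda>x\<in>X. 1 - f x) = Some (ea_one E)"
    using compl_tribe[OF that] by (auto simp: fun_eq_iff)
qed

section \<open>Central characteristic functions as multipliers\<close>

text \<open>If \<chi>_A is central, the isomorphism splits f as u + v with u \<le> \<chi>_A and v
  \<le> 1 - \<chi>_A; then v vanishes on A and u vanishes off A, which forces u = f \<chi>_A.
  Conversely, cutting by A and by its complement gives the required pair map, and pointwise addition
  inverts it.\<close>

lemma tribe_B0_iff: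
  "A \<in> B0 \<longleftrightarrow> A \<subseteq> X \<and> (\<forall>f\<in>T. (\<lambda>x\<in>X. f x * indicator A x) \<in> T)"
proof
  assume A: "A \<in> B0"
  then have AX: "A \<subseteq> X" and "chi X A \<in> ea_central E"
    by (auto simp: tribe_B0_def)
  then obtain h where chi: "chi X A \<in> T"
    and iso: "ea_iso E (ea_prod (ea_interval E (chi X A)) (ea_interval E (ea_compl E (chi X A)))) h"
    and sum: "\<And>f. f \<in> T \<Longrightarrow> ea_add E (fst (h f)) (snd (h f)) = Some f"
    unfolding ea_central_def by auto
  have "(\<lambda>x\<in>X. f x * indicator A x) \<in> T" if f: "f \<in> T" for f
  proof (rule tribe_restrict_cong)
    have mem: "h f \<in> ea_carrier (ea_prod (ea_interval E (chi X A)) (ea_interval E (ea_compl E (chi X A))))"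
      using iso f unfolding ea_iso_def ea_hom_def by auto
    then have 1: "fst (h f) \<in> T" "snd (h f) \<in> T"
      and "ea_le E (fst (h f)) (chi X A)" "ea_le E (snd (h f)) (\<lambda>x\<in>X. 1 - chi X A x)"
      by (auto simp: ea_prod_def ea_interval_def tribe_compl chi)
    then have le: "\<forall>x\<in>X. fst (h f) x \<le> chi X A x" "\<forall>x\<in>X. snd (h f) x \<le> 1 - chi X A x"
      using chi compl_tribe[OF chi] by (auto simp: tribe_le_iff)
    have eq: "(\<lambda>x\<in>X. fst (h f) x + snd (h f) x) = f"
      using sum[OF f] by (auto split: if_splits)
    show "fst (h f) \<in> T" by fact
    show "f x * indicator A x = fst (h f) x" if x: "x \<in> X" for x
    proof -
      have "fst (h f) x + snd (h f) x = f x"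
        using fun_cong[OF eq, of x] x by simp
      moreover have "fst (h f) x \<ge> 0" "snd (h f) x \<ge> 0"
        using tribe_range 1 x by auto
      ultimately show ?thesis
        using le x by (cases "x \<in> A") (force simp: chi_def)+
    qed
  qed
  then show "A \<subseteq> X \<and> (\<forall>f\<in>T. (\<lambda>x\<in>X. f x * indicator A x) \<in> T)"
    using AX by auto
next
  assume *: "A \<subseteq> X \<and> (\<forall>f\<in>T. (\<lambda>x\<in>X. f x * indicator A x) \<in> T)"
  have chi: "chi X A \<in> T"
    unfolding chi_def by (rule tribe_restrict_cong[OF bspec[OF conjunct2[OF *] one_tribe]]) auto
  define p where "p f = (\<lambda>x\<in>X. f x * indicator A x)" for f :: "'a \<Rightarrow> real"
  define q where "q f = (\<lambda>x\<in>X. f x * (1 - indicator A x))" for f :: "'a \<Rightarrow> real"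
  have pT: "p f \<in> T" if "f \<in> T" for f
    using * that by (auto simp: p_def)
  have qT: "q f \<in> T" if "f \<in> T" for f
    unfolding q_def
  proof (rule tribe_restrict_cong)
    show "(\<lambda>x\<in>X. f x - p f x) \<in> T"
      using tribe_range[OF that]
      by (intro diff_tribe pT that) (auto simp: p_def indicator_def)
  qed (auto simp: p_def algebra_simps)
  let ?I = "ea_interval E (chi X A)" and ?J = "ea_interval E (ea_compl E (chi X A))"
  have I: "f \<in> ea_carrier ?I \<longleftrightarrow> f \<in> T \<and> (\<forall>x\<in>X. f x \<le> indicator A x)" for f
    using chi by (auto simp: ea_interval_def tribe_le_iff chi_def)
  have J: "f \<in> ea_carrier ?J \<longleftrightarrow> f \<in> T \<and> (\<forall>x\<in>X. f x \<le> 1 - indicator A x)" for f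
    using chi compl_tribe[OF chi] by (auto simp: ea_interval_def tribe_compl tribe_le_iff chi_def)
  \<comment> \<open>A sum in an interval is defined only if it also lies below the unit of that
    interval, so the bound here is \<chi>_A instead of 1.\<close>
  have addI: "ea_add ?I f g = Some (\<lambda>x\<in>X. f x + g x)"
    if "f \<in> T" "g \<in> T" "\<forall>x\<in>X. f x + g x \<le> indicator A x" for f g
  proof -
    have le: "f x + g x \<le> 1" if "x \<in> X" for x
      using bspec[OF \<open>\<forall>x\<in>X. f x + g x \<le> indicator A x\<close> that] indicator_le_1 by (rule order_trans)
    then have "\<forall>x\<in>X. f x \<le> 1 - g x" by (simp add: le_diff_eq)
    with le show ?thesis
      using that chi add_tribe[of f g] by (auto simp: ea_interval_def tribe_le_iff chi_def)
  qed
  have addJ: "ea_add ?J f g = Some (\<lambda>x\<in>X. f x + g x)"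
    if "f \<in> T" "g \<in> T" "\<forall>x\<in>X. f x + g x \<le> 1 - indicator A x" for f g
  proof -
    have le: "f x + g x \<le> 1" if "x \<in> X" for x
      using bspec[OF \<open>\<forall>x\<in>X. f x + g x \<le> 1 - indicator A x\<close> that]
      by (rule order_trans) simp
    then have "\<forall>x\<in>X. f x \<le> 1 - g x" by (simp add: le_diff_eq)
    with le show ?thesis
      using that chi compl_tribe[OF chi] add_tribe[of f g]
      by (auto simp: ea_interval_def tribe_le_iff tribe_compl chi_def)
  qed
  \<comment> \<open>Elements of the first interval vanish off A and elements of the second vanish on
    A. Disjoint supports keep the sum below 1, and cutting it by A recovers the first
    summand.\<close>
  have IJD: "f x + g x \<le> 1" "f x * indicator A x = f x" "g x * indicator A x = 0"
    if "f \<in> ea_carrier ?I" "g \<in> ea_carrier ?J" "x \<in> X" for f g x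
    using that tribe_range[of f x] tribe_range[of g x] unfolding I J
    by (force simp: indicator_def split: if_splits)+
  let ?h = "\<lambda>f. (p f, q f)" and ?k = "\<lambda>u. (\<lambda>x\<in>X. fst u x + snd u x)"
  have hmem: "?h \<in> T \<rightarrow> ea_carrier ?I \<times> ea_carrier ?J"
    unfolding Pi_iff mem_Times_iff I J fst_conv snd_conv
    using pT qT tribe_range by (auto simp: p_def q_def indicator_def)
  have kmem: "?k \<in> ea_carrier ?I \<times> ea_carrier ?J \<rightarrow> T"
    using IJD by (auto intro!: add_tribe simp: I J)
  have kh: "?k (?h f) = f" if "f \<in> T" for f
    by (rule extensionalityI[of _ X])
       (auto simp: that tribe_extensional p_def q_def algebra_simps)
  have hk: "?h (?k u) = u" if u: "u \<in> ea_carrier ?I \<times> ea_carrier ?J" for u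
  proof (rule prod_eqI)
    have mem: "fst u \<in> ea_carrier ?I" "snd u \<in> ea_carrier ?J" using u by auto
    note D = IJD[OF mem]
    have ext: "fst u \<in> extensional X" "snd u \<in> extensional X"
      using mem by (auto simp: I J tribe_extensional)
    show "fst (?h (?k u)) = fst u"
      by (rule extensionalityI[of _ X]) (auto simp: p_def ext distrib_right D)
    show "snd (?h (?k u)) = snd u"
      by (rule extensionalityI[of _ X]) (auto simp: q_def ext distrib_right right_diff_distrib D)
  qed
  have carP: "ea_carrier (ea_prod ?I ?J) = ea_carrier ?I \<times> ea_carrier ?J"
    by (simp add: ea_prod_def)
  have bij: "bij_betw ?h T (ea_carrier ?I \<times> ea_carrier ?J)"
    using bij_betw_byWitness[of T ?k ?h "ea_carrier ?I \<times> ea_carrier ?J"] kh hk hmem kmem by blast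
  have inv: "inv_into T ?h u = ?k u" if "u \<in> ea_carrier ?I \<times> ea_carrier ?J" for u
    using kmem that hk[OF that] bij
    by (intro inv_into_f_eq) (auto simp: bij_betw_def)
  have hom: "ea_hom E (ea_prod ?I ?J) ?h"
    unfolding ea_hom_def carP
  proof (intro conjI ballI allI impI)
    show "?h \<in> ea_carrier E \<rightarrow> ea_carrier ?I \<times> ea_carrier ?J" using hmem by simp
    show "?h (ea_one E) = ea_one (ea_prod ?I ?J)"
      by (simp add: ea_prod_def ea_interval_def tribe_compl[OF chi])
         (auto simp: p_def q_def chi_def fun_eq_iff)
    fix f g c assume "f \<in> ea_carrier E" "g \<in> ea_carrier E" "ea_add E f g = Some c"
    then have fg: "f \<in> T" "g \<in> T" and le: "\<forall>x\<in>X. f x \<le> 1 - g x" and c: "c = (\<lambda>x\<in>X. f x + g x)"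
      by (auto split: if_splits)
    have "ea_add ?I (p f) (p g) = Some (\<lambda>x\<in>X. p f x + p g x)"
      using le by (intro addI pT fg) (auto simp: p_def indicator_def le_diff_eq)
    moreover have "ea_add ?J (q f) (q g) = Some (\<lambda>x\<in>X. q f x + q g x)"
      using le by (intro addJ qT fg) (auto simp: q_def indicator_def le_diff_eq)
    moreover have "(\<lambda>x\<in>X. p f x + p g x) = p c" "(\<lambda>x\<in>X. q f x + q g x) = q c"
      by (auto simp: p_def q_def c algebra_simps fun_eq_iff)
    ultimately show "ea_add (ea_prod ?I ?J) (?h f) (?h g) = Some (?h c)"
      by (simp add: ea_prod_def)
  qed
  have hom_inv: "ea_hom (ea_prod ?I ?J) E (inv_into T ?h)"
    unfolding ea_hom_def carP
  proof (intro conjI ballI allI impI)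
    show "inv_into T ?h \<in> ea_carrier ?I \<times> ea_carrier ?J \<rightarrow> ea_carrier E"
      using kmem inv by (auto simp: Pi_iff)
    \<comment> \<open>\<open>?h\<close> preserves the unit, so its inverse does too, by
      injectivity.\<close>
    have one: "ea_one (ea_prod ?I ?J) = ?h (ea_one E)"
      using hom by (simp add: ea_hom_def)
    show "inv_into T ?h (ea_one (ea_prod ?I ?J)) = ea_one E"
      unfolding one using inv_into_f_f[OF bij_betw_imp_inj_on[OF bij], of "ea_one E"] one_tribe by simp
    fix u v w assume u: "u \<in> ea_carrier ?I \<times> ea_carrier ?J" and v: "v \<in> ea_carrier ?I \<times> ea_carrier ?J"
      and w: "ea_add (ea_prod ?I ?J) u v = Some w"
    from w have s: "ea_add ?I (fst u) (fst v) = Some (fst w)" "ea_add ?J (snd u) (snd v) = Some (snd w)"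
      by (auto simp: ea_prod_def split: option.splits)
    have w1: "fst w = (\<lambda>x\<in>X. fst u x + fst v x)" and leI: "ea_le E (fst w) (chi X A)"
      and wT1: "\<forall>x\<in>X. fst u x \<le> 1 - fst v x"
      using s(1) by (auto simp: ea_interval_def split: if_splits)
    have w2: "snd w = (\<lambda>x\<in>X. snd u x + snd v x)" and leJ: "ea_le E (snd w) (ea_compl E (chi X A))"
      and wT2: "\<forall>x\<in>X. snd u x \<le> 1 - snd v x"
      using s(2) by (auto simp: ea_interval_def split: if_splits)
    \<comment> \<open>The components of \<open>w\<close> must be placed in their intervals before
      \<open>IJD\<close> applies to them. It then bounds the sum of all four summands by 1, so
      \<open>?k u\<close> and \<open>?k v\<close> are summable in \<open>E\<close>.\<close>
    have "fst w \<in> T" "snd w \<in> T"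
      unfolding w1 w2 using u v wT1 wT2 by (auto intro!: add_tribe simp: I J le_diff_eq)
    then have W: "fst w \<in> ea_carrier ?I" "snd w \<in> ea_carrier ?J"
      using leI leJ by (auto simp: ea_interval_def)
    have "fst u x + snd u x \<le> 1 - (fst v x + snd v x)" if "x \<in> X" for x
      using IJD(1)[OF W that] that by (simp add: w1 w2)
    then have "ea_add E (?k u) (?k v) = Some (?k w)"
      by (auto simp: w1 w2 fun_eq_iff)
    moreover have "w \<in> ea_carrier ?I \<times> ea_carrier ?J"
      using W by (simp add: mem_Times_iff)
    ultimately show "ea_add E (inv_into T ?h u) (inv_into T ?h v) = Some (inv_into T ?h w)"
      using u v by (simp only: inv)
  qed
  have "ea_iso E (ea_prod ?I ?J) ?h"
    using bij hom hom_inv by (simp add: ea_iso_def carP)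
  moreover have "?h (chi X A) = (chi X A, ea_zero E)"
    by (auto simp: p_def q_def chi_def fun_eq_iff indicator_def)
  moreover have "\<forall>f\<in>T. ea_add E (fst (?h f)) (snd (?h f)) = Some f"
  proof
    fix f assume f: "f \<in> T"
    have "\<forall>x\<in>X. p f x \<le> 1 - q f x"
      using tribe_range[OF f] by (auto simp: p_def q_def indicator_def)
    then show "ea_add E (fst (?h f)) (snd (?h f)) = Some f"
      using kh[OF f] by simp
  qed
  ultimately have "chi X A \<in> ea_central E"
    unfolding ea_central_def tribe_algebra_simps(1) using chi by blast
  then show "A \<in> B0" using * by (simp add: tribe_B0_def)
qed

section \<open>\<open>B0\<close> as a \<sigma>-algebra\<close>

lemma mult_indicator_tribe:
  "A \<in> B0 \<Longrightarrow> f \<in> T \<Longrightarrow> (\<lambda>x\<in>X. f x * indicator A x) \<in> T"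
  by (simp add: tribe_B0_iff)

lemma chi_tribe: "A \<in> B0 \<Longrightarrow> chi X A \<in> T"
  by (simp add: tribe_B0_def ea_central_def)

lemma tribe_B0_Diff: "X - A \<in> B0" if A: "A \<in> B0"
  unfolding tribe_B0_iff
proof (intro conjI ballI)
  fix f assume f: "f \<in> T"
  show "(\<lambda>x\<in>X. f x * indicator (X - A) x) \<in> T"
  proof (rule tribe_restrict_cong)
    show "(\<lambda>x\<in>X. f x - (\<lambda>x\<in>X. f x * indicator A x) x) \<in> T"
      using tribe_range[OF f]
      by (intro diff_tribe mult_indicator_tribe A f) (auto simp: indicator_def)
  qed (auto simp: indicator_def)
qed auto

lemma tribe_B0_Int: "A \<inter> B \<in> B0" if A: "A \<in> B0" and B: "B \<in> B0"
  unfolding tribe_B0_iff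
proof (intro conjI ballI)
  show "A \<inter> B \<subseteq> X" using A by (auto simp: tribe_B0_iff)
  fix f assume f: "f \<in> T"
  show "(\<lambda>x\<in>X. f x * indicator (A \<inter> B) x) \<in> T"
    by (rule tribe_restrict_cong[OF mult_indicator_tribe[OF A mult_indicator_tribe[OF B f]]])
       (auto simp: indicator_def)
qed

text \<open>In multiplier form, countable unions reduce to the monotone limit axiom of the tribe:
  since f \<ge> 0, f times the indicators of the partial unions increases to f times the indicator
  of the union.\<close>

lemma sigma_algebra_tribe_B0: "sigma_algebra X B0"
proof -
  have sub: "B0 \<subseteq> Pow X" by (auto simp: tribe_B0_def)
  have "X \<in> B0"
    unfolding tribe_B0_iff
    by (auto intro: tribe_restrict_cong)
  with tribe_B0_Diff have "{} \<in> B0" by (metis Diff_cancel)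
  interpret algebra X B0
  proof (subst algebra_iff_Int, intro conjI ballI)
  qed (use sub \<open>{} \<in> B0\<close> tribe_B0_Diff tribe_B0_Int in auto)
  show ?thesis
    unfolding sigma_algebra_iff2
  proof (intro conjI allI impI)
    fix A :: "nat \<Rightarrow> 'a set" assume A: "range A \<subseteq> B0"
    define C where "C n = (\<Union>i\<le>n. A i)" for n
    have C: "C n \<in> B0" for n unfolding C_def using A by auto
    show "(\<Union>i. A i) \<in> B0"
      unfolding tribe_B0_iff
    proof (intro conjI ballI)
      show "(\<Union>i. A i) \<subseteq> X" using A sub by auto
      fix f assume f: "f \<in> T"
      have inc: "incseq C" and "(\<Union>n. C n) = (\<Union>i. A i)"
        by (force simp: C_def incseq_def)+
      then have lim: "(\<lambda>n. indicator (C n) x :: real) \<longlonglongrightarrow> indicator (\<Union>i. A i) x" for x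
        using LIMSEQ_indicator_incseq[of C] by metis
      show "(\<lambda>x\<in>X. f x * indicator (\<Union>i. A i) x) \<in> T"
      proof (rule lim_tribe[where F = "\<lambda>n. \<lambda>x\<in>X. f x * indicator (C n) x"])
        show "(\<lambda>x\<in>X. f x * indicator (C n) x) \<in> T" for n
          by (rule mult_indicator_tribe[OF C f])
        fix x assume x: "x \<in> X"
        show "(\<lambda>x\<in>X. f x * indicator (C n) x) x \<le> (\<lambda>x\<in>X. f x * indicator (C (Suc n)) x) x" for n
          using x tribe_range[OF f x] incseq_SucD[OF inc, of n] by (auto simp: indicator_def)
        show "(\<lambda>n. (\<lambda>x\<in>X. f x * indicator (C n) x) x) \<longlonglongrightarrow> f x * indicator (\<Union>i. A i) x"
          using tendsto_mult[OF tendsto_const lim, of "f x"] x by simp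
      qed
    qed
  qed (use sub \<open>{} \<in> B0\<close> tribe_B0_Diff in auto)
qed

section \<open>The doubling map and bounded additive functionals\<close>

text \<open>The map is pasted from two pieces: f + f where f < 1/2, and 1 - 2(1 - f) on the rest.
  The detour through 1 - f \<le> 1/2 is needed because f + f may exceed 1 there.\<close>

lemma doubling_tribe:
  assumes f: "f \<in> T" and A: "{x\<in>X. f x < 1/2} \<in> B0"
  obtains g where "g \<in> T"
    and "\<And>x. x \<in> X \<Longrightarrow> g x = (if f x < 1/2 then 2 * f x else 2 * f x - 1)"
proof
  let ?A = "{x\<in>X. f x < 1/2}"
  define lo where "lo = (\<lambda>x\<in>X. f x * indicator ?A x)"
  define hi where "hi = (\<lambda>x\<in>X. (\<lambda>x\<in>X. 1 - f x) x * indicator (X - ?A) x)"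
  have T: "lo \<in> T" "hi \<in> T"
    unfolding lo_def hi_def by (intro mult_indicator_tribe tribe_B0_Diff compl_tribe A f)+
  define lo2 where "lo2 = (\<lambda>x\<in>X. lo x + lo x)"
  define hi2 where "hi2 = (\<lambda>x\<in>X. chi X (X - ?A) x - (\<lambda>x\<in>X. hi x + hi x) x)"
  have T2: "lo2 \<in> T"
    unfolding lo2_def by (intro add_tribe T) (auto simp: lo_def indicator_def)
  have T3: "hi2 \<in> T"
    unfolding hi2_def using tribe_range[OF f]
    by (intro diff_tribe add_tribe T chi_tribe tribe_B0_Diff A) (auto simp: hi_def chi_def indicator_def)
  show "(\<lambda>x\<in>X. lo2 x + hi2 x) \<in> T"
    using tribe_range[OF f]
    by (intro add_tribe T2 T3) (auto simp: hi2_def lo2_def lo_def hi_def chi_def indicator_def)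
  show "(\<lambda>x\<in>X. lo2 x + hi2 x) x = (if f x < 1/2 then 2 * f x else 2 * f x - 1)" if "x \<in> X" for x
    using that by (auto simp: hi2_def lo2_def lo_def hi_def chi_def indicator_def)
qed

text \<open>Let A be the set where f < 1/2 and C its complement; \<open>d\<close> splits along A and
  C. On A, g is f + f. On C, with r = 1 - f, the function \<chi>_C is both f + r and g + 2r; since
  \<open>d\<close> vanishes at \<chi>_C, the parts of f and g on C have values -d(r) and -2
  d(r).\<close>

lemma additive_doubling:
  fixes d :: "('a \<Rightarrow> real) \<Rightarrow> real"
  assumes add: "\<And>f g. f \<in> T \<Longrightarrow> g \<in> T \<Longrightarrow> (\<And>x. x \<in> X \<Longrightarrow> f x + g x \<le> 1) \<Longrightarrow>
      d (\<lambda>x\<in>X. f x + g x) = d f + d g"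
    and zero: "\<And>A. A \<in> B0 \<Longrightarrow> d (chi X A) = 0"
    and f: "f \<in> T" and A: "{x\<in>X. f x < 1/2} \<in> B0"
    and g: "g \<in> T" "\<And>x. x \<in> X \<Longrightarrow> g x = (if f x < 1/2 then 2 * f x else 2 * f x - 1)"
  shows "d g = 2 * d f"
proof -
  define A where "A = {x\<in>X. f x < 1/2}"
  define C where "C = X - A"
  have AB: "A \<in> B0" and CB: "C \<in> B0"
    using A tribe_B0_Diff by (auto simp: A_def C_def)
  define cut where "cut B u = (\<lambda>x\<in>X. u x * indicator B x)" for B and u :: "'a \<Rightarrow> real"
  have cut: "cut B u \<in> T" if "B \<in> B0" "u \<in> T" for B u
    using mult_indicator_tribe that by (simp add: cut_def)
  have cut_apply: "cut B u x = u x * indicator B x" if "x \<in> X" for B u x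
    using that by (simp add: cut_def)
  have indC: "indicator C x = (1 - indicator A x :: real)" if "x \<in> X" for x
    using that by (simp add: C_def indicator_def)
  have gA: "g x = 2 * f x - 1 + indicator A x" if "x \<in> X" for x
    using that by (simp add: A_def indicator_def g(2))
  \<comment> \<open>The bound required by \<open>add\<close> is automatic once the pointwise sum is
    a member of \<open>T\<close>, so below it suffices to compare values.\<close>
  have sum: "d w = d u + d v"
    if "u \<in> T" "v \<in> T" "w \<in> T" "\<And>x. x \<in> X \<Longrightarrow> w x = u x + v x" for u v w
  proof -
    have "(\<lambda>x\<in>X. u x + v x) = w"
      by (rule extensionalityI[of _ X]) (use that in \<open>auto simp: tribe_extensional\<close>)
    moreover have "u x + v x \<le> 1" if "x \<in> X" for x
      using \<open>w \<in> T\<close> \<open>\<And>x. x \<in> X \<Longrightarrow> w x = u x + v x\<close> tribe_range that by metis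
    ultimately show ?thesis using add[of u v] that by simp
  qed
  have split: "d u = d (cut A u) + d (cut C u)" if "u \<in> T" for u
    by (rule sum) (simp_all add: that cut AB CB cut_apply indC algebra_simps)
  \<comment> \<open>On C the value of f is at least 1/2, so \<open>r\<close> is at most 1/2 and
    \<open>r + r\<close> is still in \<open>T\<close>.\<close>
  define r where "r = cut C (\<lambda>x\<in>X. 1 - f x)"
  have r: "r \<in> T" unfolding r_def by (intro cut CB compl_tribe f)
  have r_apply: "r x = (1 - f x) * (1 - indicator A x)" if "x \<in> X" for x
    using that by (simp add: r_def cut_apply indC)
  define rr where "rr = (\<lambda>x\<in>X. r x + r x)"
  have rr: "rr \<in> T"
    unfolding rr_def using r by (intro add_tribe) (auto simp: r_apply A_def indicator_def)
  have rr_apply: "rr x = r x + r x" if "x \<in> X" for x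
    using that by (simp add: rr_def)
  have "d (cut A g) = d (cut A f) + d (cut A f)"
    by (rule sum) (simp_all add: cut AB f g(1) cut_apply gA indicator_def)
  then have lo: "d (cut A g) = 2 * d (cut A f)" by simp
  have chi_apply: "chi X C x = 1 - indicator A x" if "x \<in> X" for x
    using that by (simp add: chi_def indC)
  have "d (chi X C) = d (cut C f) + d r"
    by (rule sum) (simp_all add: cut CB f r chi_tribe cut_apply r_apply chi_apply indC algebra_simps)
  moreover have "d (chi X C) = d (cut C g) + d rr"
    by (rule sum)
       (simp_all add: cut CB g(1) rr chi_tribe cut_apply r_apply rr_apply chi_apply indC gA
         split: split_indicator)
  moreover have "d rr = d r + d r"
    by (rule sum) (simp_all add: r rr rr_apply)
  ultimately have "d (cut C g) = 2 * d (cut C f)"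
    using zero[OF CB] by simp
  then show ?thesis using split[OF f] split[OF g(1)] lo by simp
qed

text \<open>Iterated doubling never leaves \<open>T\<close>, where \<open>K\<close> bounds
  \<open>d\<close>, while the value of \<open>d\<close> doubles each time. Measurability enters
  through the level 1/2 of every iterate.\<close>

lemma additive_bounded_eq_0:
  fixes d :: "('a \<Rightarrow> real) \<Rightarrow> real"
  assumes add: "\<And>f g. f \<in> T \<Longrightarrow> g \<in> T \<Longrightarrow> (\<And>x. x \<in> X \<Longrightarrow> f x + g x \<le> 1) \<Longrightarrow>
      d (\<lambda>x\<in>X. f x + g x) = d f + d g"
    and zero: "\<And>A. A \<in> B0 \<Longrightarrow> d (chi X A) = 0"
    and bound: "\<And>f. f \<in> T \<Longrightarrow> \<bar>d f\<bar> \<le> K"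
    and meas: "\<And>f. f \<in> T \<Longrightarrow> {x\<in>X. f x < 1/2} \<in> B0"
    and f: "f \<in> T"
  shows "d f = 0"
proof -
  \<comment> \<open>The induction must range over all of \<open>T\<close>, since its hypothesis is
    applied to the doubled function.\<close>
  have pow: "2 ^ n * \<bar>d f\<bar> \<le> K" if "f \<in> T" for n f
    using that
  proof (induction n arbitrary: f)
    case 0
    then show ?case using bound by simp
  next
    case (Suc n)
    obtain g where g: "g \<in> T" "\<And>x. x \<in> X \<Longrightarrow> g x = (if f x < 1/2 then 2 * f x else 2 * f x - 1)"
      using doubling_tribe[OF Suc.prems meas[OF Suc.prems]] by blast
    have "d g = 2 * d f"
      by (rule additive_doubling[OF add zero Suc.prems meas[OF Suc.prems] g])
    then show ?case using Suc.IH[OF g(1)] by (simp add: abs_mult)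
  qed
  show ?thesis
  proof (rule ccontr)
    assume "d f \<noteq> 0"
    obtain n where "K / \<bar>d f\<bar> < 2 ^ n"
      using real_arch_pow[of 2] by auto
    then show False
      using pow[OF f, of n] \<open>d f \<noteq> 0\<close> by (simp add: divide_simps)
  qed
qed

end

section \<open>The measure induced by a \<sigma>-additive state\<close>

locale tribe_state = effect_tribe_loc +
  fixes s :: "('a \<Rightarrow> real) \<Rightarrow> real"
  assumes state: "ea_state E s" and sigma_additive: "ea_sigma_additive E s"
begin

lemma state_range: "f \<in> T \<Longrightarrow> 0 \<le> s f" "f \<in> T \<Longrightarrow> s f \<le> 1"
  using state by (auto simp: ea_state_def Pi_iff)

lemma state_add:
  assumes "f \<in> T" "g \<in> T" "\<And>x. x \<in> X \<Longrightarrow> f x + g x \<le> 1"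
  shows "s (\<lambda>x\<in>X. f x + g x) = s f + s g"
proof -
  have "ea_add E f g = Some (\<lambda>x\<in>X. f x + g x)"
    using assms by (simp add: le_diff_eq)
  then show ?thesis using state assms unfolding ea_state_def tribe_algebra_simps(1) by blast
qed

lemma tribe_mu_UNIV: "tribe_mu X s X = 1"
proof -
  have "chi X X = (\<lambda>x\<in>X. 1)" by (auto simp: chi_def fun_eq_iff)
  then show ?thesis using state by (simp add: tribe_mu_def ea_state_def)
qed

lemma tribe_mu_range: "A \<in> B0 \<Longrightarrow> 0 \<le> tribe_mu X s A" "A \<in> B0 \<Longrightarrow> tribe_mu X s A \<le> 1"
  by (simp_all add: tribe_mu_def state_range chi_tribe)

lemma tribe_mu_Un:
  assumes "A \<in> B0" "B \<in> B0" "A \<inter> B = {}"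
  shows "tribe_mu X s (A \<union> B) = tribe_mu X s A + tribe_mu X s B"
proof -
  have "(\<lambda>x\<in>X. chi X A x + chi X B x) = chi X (A \<union> B)"
    using assms(3) by (auto simp: chi_def fun_eq_iff indicator_def)
  moreover have "chi X A x + chi X B x \<le> 1" if "x \<in> X" for x
    using assms(3) that by (auto simp: chi_def indicator_def)
  ultimately show ?thesis
    using state_add[of "chi X A" "chi X B"] assms by (simp add: tribe_mu_def chi_tribe)
qed

text \<open>\<sigma>-additivity of \<open>s\<close> speaks of suprema in the order of
  \<open>T\<close>, not of pointwise limits. An upper bound in \<open>T\<close> is at least 1 on
  every \<open>C n\<close> and nonnegative elsewhere, so the characteristic function of the union is
  the least one.\<close>

lemma tribe_mu_incseq:
  assumes C: "range C \<subseteq> B0" "incseq C" "(\<Union>n. C n) \<in> B0"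
  shows "(\<lambda>n. tribe_mu X s (C n)) \<longlonglongrightarrow> tribe_mu X s (\<Union>n. C n)"
proof -
  have T: "chi X (C n) \<in> T" for n using C by (auto intro: chi_tribe)
  have UT: "chi X (\<Union>n. C n) \<in> T" using C by (auto intro: chi_tribe)
  have "ea_le E (chi X (C n)) (chi X (C (Suc n)))" for n
    using T incseq_SucD[OF C(2), of n] by (auto simp: tribe_le_iff chi_def indicator_def)
  moreover have "ea_is_sup E (range (\<lambda>n. chi X (C n))) (chi X (\<Union>n. C n))"
    unfolding ea_is_sup_def
  proof (intro conjI ballI impI)
    show "ea_le E b (chi X (\<Union>n. C n))" if "b \<in> range (\<lambda>n. chi X (C n))" for b
      using that T UT by (auto simp: tribe_le_iff chi_def indicator_def)
    fix u assume u: "u \<in> ea_carrier E" "\<forall>b\<in>range (\<lambda>n. chi X (C n)). ea_le E b u"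
    then have le: "chi X (C n) x \<le> u x" if "x \<in> X" for n x
      using T that by (auto simp: tribe_le_iff)
    have "1 \<le> u x" if "x \<in> X" "x \<in> C n" for x n
      using le[of x n] that by (simp add: chi_def)
    then show "ea_le E (chi X (\<Union>n. C n)) u"
      using u UT tribe_range by (auto simp: tribe_le_iff chi_def indicator_def)
  qed (use UT in auto)
  moreover have "range (\<lambda>n. chi X (C n)) \<subseteq> ea_carrier E" using T by auto
  ultimately show ?thesis
    using sigma_additive unfolding ea_sigma_additive_def tribe_mu_def by blast
qed

text \<open>\<open>measure_of\<close> yields the null measure unless the set function is a measure,
  so the intended values are available only through \<open>emeasure_mu\<close>.\<close>

definition mu :: "'a measure" where
  "mu = measure_of X B0 (\<lambda>A. ennreal (tribe_mu X s A))"

lemma space_mu: "space mu = X"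
  and sets_mu: "sets mu = B0"
proof -
  have "B0 \<subseteq> Pow X" by (auto simp: tribe_B0_def)
  then show "space mu = X" "sets mu = B0"
    unfolding mu_def using sigma_algebra.sigma_sets_eq[OF sigma_algebra_tribe_B0]
    by (simp_all add: space_measure_of sets_measure_of)
qed

lemma emeasure_mu: "emeasure mu A = ennreal (tribe_mu X s A)" if A: "A \<in> B0"
  unfolding mu_def
proof (rule emeasure_measure_of_sigma[OF sigma_algebra_tribe_B0])
  let ?m = "\<lambda>A. ennreal (tribe_mu X s A)"
  interpret sigma_algebra X B0 by (rule sigma_algebra_tribe_B0)
  have "tribe_mu X s {} = 0"
    using tribe_mu_Un[of "{}" "{}"] by simp
  then show pos: "positive B0 ?m"
    by (simp add: positive_def)
  have add: "additive B0 ?m"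
    by (simp add: additive_def tribe_mu_Un tribe_mu_range)
  \<comment> \<open>Given finite additivity, countable additivity is continuity along increasing
    sequences, which is \<open>tribe_mu_incseq\<close>.\<close>
  show "countably_additive B0 ?m"
    unfolding countably_additive_iff_continuous_from_below[OF pos add]
    by (auto intro!: tendsto_ennrealI tribe_mu_incseq)
qed (fact A)

lemma measure_mu: "measure mu A = tribe_mu X s A" if "A \<in> B0"
  using that by (simp add: measure_def emeasure_mu tribe_mu_range)

lemma prob_mu: "prob_measure_on X B0 mu"
proof -
  have "X \<in> B0" using sets.top[of mu] by (simp add: space_mu sets_mu)
  then have "prob_space mu"
    by (intro prob_spaceI) (simp add: space_mu emeasure_mu tribe_mu_UNIV)
  then show ?thesis by (simp add: prob_measure_on_def space_mu sets_mu)
qed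

section \<open>Integral representation and uniqueness\<close>

text \<open>Stated for arbitrary \<open>N\<close> because it serves both \<open>mu\<close> and any
  competing measure. The condition on the space matters: \<open>chi X A\<close> is
  \<open>undefined\<close> off \<open>X\<close>.\<close>

lemma integral_chi: "(\<integral>x. chi X A x \<partial>N) = measure N A"
  if "space N = X" "A \<in> sets N"
proof -
  have "(\<integral>x. chi X A x \<partial>N) = (\<integral>x. indicator A x \<partial>N)"
    using that by (intro Bochner_Integration.integral_cong) (auto simp: chi_def)
  then show ?thesis using that sets.sets_into_space[of A N] by (simp add: Int_absorb2)
qed

lemma state_eq_integral:
  assumes meas: "\<And>f. f \<in> T \<Longrightarrow> f \<in> borel_measurable mu" and f: "f \<in> T"
  shows "s f = (\<integral>x. f x \<partial>mu)"
proof -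
  interpret prob_space mu using prob_mu by (simp add: prob_measure_on_def)
  have int: "integrable mu f" if "f \<in> T" for f
    using that meas tribe_range
    by (intro integrable_const_bound[where B = 1]) (auto simp: space_mu)
  have int_range: "0 \<le> (\<integral>x. f x \<partial>mu)" "(\<integral>x. f x \<partial>mu) \<le> 1" if "f \<in> T" for f
    using int[OF that] tribe_range[OF that] prob_space
    by (auto intro!: integral_nonneg_AE integral_le_const simp: space_mu)
  have "s f - (\<integral>x. f x \<partial>mu) = 0"
  \<comment> \<open>The state and the integral both take values in [0,1], hence
    \<open>K = 1\<close>. The defect vanishes at each \<chi>_A because \<open>mu\<close> is built
    from these values of \<open>s\<close>.\<close>
  proof (rule additive_bounded_eq_0[where d = "\<lambda>f. s f - (\<integral>x. f x \<partial>mu)" and K = 1])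
    fix f assume f: "f \<in> T"
    show "\<bar>s f - (\<integral>x. f x \<partial>mu)\<bar> \<le> 1"
      using state_range[OF f] int_range[OF f] by linarith
    have "{x\<in>space mu. f x < 1/2} \<in> sets mu"
      using meas[OF f] by measurable
    then show "{x\<in>X. f x < 1/2} \<in> B0" by (simp add: space_mu sets_mu)
    fix g assume g: "g \<in> T" and le: "\<And>x. x \<in> X \<Longrightarrow> f x + g x \<le> 1"
    have "(\<integral>x. (\<lambda>x\<in>X. f x + g x) x \<partial>mu) = (\<integral>x. f x + g x \<partial>mu)"
      by (rule Bochner_Integration.integral_cong) (auto simp: space_mu)
    then show "s (\<lambda>x\<in>X. f x + g x) - (\<integral>x. (\<lambda>x\<in>X. f x + g x) x \<partial>mu) =
        s f - (\<integral>x. f x \<partial>mu) + (s g - (\<integral>x. g x \<partial>mu))"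
      using int[OF f] int[OF g] state_add[OF f g le] by simp
  next
    fix A assume "A \<in> B0"
    then show "s (chi X A) - (\<integral>x. chi X A x \<partial>mu) = 0"
      by (simp add: integral_chi space_mu sets_mu measure_mu tribe_mu_def)
  qed fact
  then show ?thesis by simp
qed

text \<open>Since \<chi>_A lies in \<open>T\<close>, evaluating the representation at \<chi>_A reads
  off the measure of A.\<close>

lemma representing_measure:
  assumes N: "prob_measure_on X B0 N" and eq: "\<forall>f\<in>T. s f = (\<integral>x. f x \<partial>N)" and A: "A \<in> B0"
  shows "measure N A = tribe_mu X s A"
  using assms chi_tribe[OF A] integral_chi[of N A]
  by (auto simp: prob_measure_on_def tribe_mu_def)

lemma representing_measure_unique:
  assumes N: "prob_measure_on X B0 N" and eq: "\<forall>f\<in>T. s f = (\<integral>x. f x \<partial>N)"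
  shows "N = mu"
proof (rule measure_eqI)
  show "sets N = sets mu" using N by (simp add: prob_measure_on_def sets_mu)
  fix A assume "A \<in> sets N"
  then have A: "A \<in> B0" using N by (simp add: prob_measure_on_def)
  interpret N: prob_space N using N by (simp add: prob_measure_on_def)
  show "emeasure N A = emeasure mu A"
    using representing_measure[OF N eq A] by (simp add: N.emeasure_eq_measure emeasure_mu A)
qed

end

theorem theorem4p4:
  fixes X :: "'a set" and T :: "('a \<Rightarrow> real) set" and s :: "('a \<Rightarrow> real) \<Rightarrow> real"
  assumes "X \<noteq> {}"
    and "effect_tribe X T"
    and "ea_RDP (tribe_algebra X T)"
    and "\<forall>f\<in>T. f \<in> borel_measurable (sigma X (tribe_B0 X T))"
    and "ea_state (tribe_algebra X T) s"
    and "ea_sigma_additive (tribe_algebra X T) s"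
  shows "(\<exists>!\<mu>. prob_measure_on X (tribe_B0 X T) \<mu> \<and> (\<forall>f\<in>T. s f = (\<integral>x. f x \<partial>\<mu>))) \<and>
         (\<forall>\<mu>. prob_measure_on X (tribe_B0 X T) \<mu> \<and> (\<forall>f\<in>T. s f = (\<integral>x. f x \<partial>\<mu>)) \<longrightarrow>
              (\<forall>A\<in>tribe_B0 X T. measure \<mu> A = tribe_mu X s A))"
proof -
  interpret tribe_state X T s
    by standard fact+
  \<comment> \<open>\<open>B0\<close> is already a \<sigma>-algebra, so generating from it adds no
    sets, and the assumed measurability passes to \<open>mu\<close>.\<close>
  have "sets (sigma X B0) = sets mu"
    using sigma_algebra.sigma_sets_eq[OF sigma_algebra_tribe_B0]
    by (subst sets_measure_of) (auto simp: sets_mu tribe_B0_def)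
  then have meas: "f \<in> borel_measurable mu" if "f \<in> T" for f
    using assms(4) that by (simp cong: measurable_cong_sets)
  have rep: "prob_measure_on X B0 mu \<and> (\<forall>f\<in>T. s f = (\<integral>x. f x \<partial>mu))"
    using prob_mu state_eq_integral[OF meas] by blast
  show ?thesis
    using rep representing_measure_unique representing_measure by blast
qed

end
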